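(* For all $\Gamma\cup\{A\}\subseteq \mathsf{Form}_\supset$: if $\Gamma\vdash A$ in the system $\mathbf{S}$, then $\Gamma\models A$.
   Context: Language: formulas $\mathsf{Form}_\supset$ are built from a countable set $\mathsf{Prop}$ of propositional variables using the binary connectives $\land,\lor,\to$ (intuitionistic implication) and $\supset$ (classical implication). Semantics: an $\mathbf{S}$-model is $\langle g,W,\leq,V\rangle$ where $W$ is a set, $g\in W$, $\leq$ is a reflexive and transitive relation on $W$ with $g\leq w$ for all $w\in W$, and $V:W\times\mathsf{Prop}\to\{0,1\}$ satisfies: if $V(w_1,p)=1$ and $w_1\leq w_2$ then $V(w_2,p)=1$. $V$ extends to $I$: $I(w,p)=V(w,p)$; $I(w,A\land B)=1$ iff $I(w,A)=1$ and $I(w,B)=1$; $I(w,A\lor B)=1$ iff $I(w,A)=1$ or $I(w,B)=1$; $I(w,A\supset B)=1$ iff $I(g,A)\neq 1$ or $I(w,B)=1$; $I(w,A\to B)=1$ iff for all $x\in W$ with $w\leq x$, $I(x,A)=1$ implies $I(x,B)=1$. $\Sigma\models A$ iff for every $\mathbf{S}$-model, if $I(g,B)=1$ for all $B\in\Sigma$ then $I(g,A)=1$. Proof system $\mathbf{S}$: axiom schemata (for all formulas $A,B,C$) (Ax1) $A\to(B\to A)$; (Ax2) $(A\to(B\to C))\to((A\to B)\to(A\to C))$; (Ax3) $(A\land B)\to A$; (Ax4) $(A\land B)\to B$; (Ax5) $(C\to A)\to((C\to B)\to(C\to(A\land B)))$; (Ax6) $A\to(A\lor B)$; (Ax7) $B\to(A\lor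 B)$; (Ax8) $(A\to C)\to((B\to C)\to((A\lor B)\to C))$; (AxM1) $(A\to B)\supset(A\supset B)$; (AxM2) $(A\supset(B\supset C))\to((A\supset B)\supset(A\supset C))$; (AxM3) $(A\supset(B\to C))\to(B\to(A\supset C))$; (AxM4) $(A\to(B\supset C))\to(B\supset(A\to C))$; (AxM5) $((A\supset B)\supset C)\to((A\supset C)\to C)$; (AxM6) $(A\supset C)\to((B\supset C)\to((A\lor B)\supset C))$; and the single rule (MP): from $A$ and $A\supset B$ infer $B$. $\Gamma\vdash A$ iff there is a finite sequence ending in $A$ each member of which is in $\Gamma$, an axiom instance, or obtained by (MP) from earlier members. *)

theory Defs
  imports "HOL-Library.Countable"
begin

datatype 'p form =
    Var 'p
  | And "'p form" "'p form"  (infixr "\<^bold>\<and>" 67)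
  | Or "'p form" "'p form"   (infixr "\<^bold>\<or>" 66)
  | IImp "'p form" "'p form" (infixr "\<^bold>\<rightarrow>" 65) \<comment> \<open>intuitionistic implication\<close>
  | CImp "'p form" "'p form" (infixr "\<^bold>\<supset>" 65) \<comment> \<open>classical implication\<close>

text \<open>The truth values 1 and 0 are rendered as \<^term>\<open>True\<close> and \<^term>\<open>False\<close>. The set of
  worlds is a subset of a type; values of the valuation outside it are irrelevant.\<close>

record ('w, 'p) model =
  base :: 'w
  worlds :: "'w set"
  acc :: "('w \<times> 'w) set"
  val :: "'w \<Rightarrow> 'p \<Rightarrow> bool"

definition S_model :: "('w, 'p) model \<Rightarrow> bool" where
  "S_model M \<longleftrightarrow>
     base M \<in> worlds M \<and>
     preorder_on (worlds M) (acc M) \<and>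
     (\<forall>w\<in>worlds M. (base M, w) \<in> acc M) \<and>
     (\<forall>w\<^sub>1\<in>worlds M. \<forall>w\<^sub>2\<in>worlds M. \<forall>p.
        val M w\<^sub>1 p \<longrightarrow> (w\<^sub>1, w\<^sub>2) \<in> acc M \<longrightarrow> val M w\<^sub>2 p)"

primrec interp :: "('w, 'p) model \<Rightarrow> 'w \<Rightarrow> 'p form \<Rightarrow> bool" where
  "interp M w (Var p) \<longleftrightarrow> val M w p"
| "interp M w (A \<^bold>\<and> B) \<longleftrightarrow> interp M w A \<and> interp M w B"
| "interp M w (A \<^bold>\<or> B) \<longleftrightarrow> interp M w A \<or> interp M w B"
| "interp M w (A \<^bold>\<rightarrow> B) \<longleftrightarrow>
     (\<forall>x\<in>worlds M. (w, x) \<in> acc M \<longrightarrow> interp M x A \<longrightarrow> interp M x B)"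
| "interp M w (A \<^bold>\<supset> B) \<longleftrightarrow> \<not> interp M (base M) A \<or> interp M w B"

text \<open>HOL cannot quantify over all types inside a formula, so the type \<open>'w\<close> from which worlds are
  drawn is a parameter. Consequence over all models is \<open>entails TYPE('w) \<Sigma> A\<close> for
  every type \<open>'w\<close>, i.e. with \<open>'w\<close> a free type variable of a theorem's conclusion.\<close>

definition entails :: "'w itself \<Rightarrow> 'p form set \<Rightarrow> 'p form \<Rightarrow> bool" where
  "entails (_ :: 'w itself) \<Sigma> A \<longleftrightarrow>
     (\<forall>M :: ('w, 'p) model. S_model M \<longrightarrow>
        (\<forall>B\<in>\<Sigma>. interp M (base M) B) \<longrightarrow> interp M (base M) A)"

inductive S_axiom :: "'p form \<Rightarrow> bool" where
  Ax1: "S_axiom (A \<^bold>\<rightarrow> (B \<^bold>\<rightarrow> A))"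
| Ax2: "S_axiom ((A \<^bold>\<rightarrow> (B \<^bold>\<rightarrow> C)) \<^bold>\<rightarrow> ((A \<^bold>\<rightarrow> B) \<^bold>\<rightarrow> (A \<^bold>\<rightarrow> C)))"
| Ax3: "S_axiom ((A \<^bold>\<and> B) \<^bold>\<rightarrow> A)"
| Ax4: "S_axiom ((A \<^bold>\<and> B) \<^bold>\<rightarrow> B)"
| Ax5: "S_axiom ((C \<^bold>\<rightarrow> A) \<^bold>\<rightarrow> ((C \<^bold>\<rightarrow> B) \<^bold>\<rightarrow> (C \<^bold>\<rightarrow> (A \<^bold>\<and> B))))"
| Ax6: "S_axiom (A \<^bold>\<rightarrow> (A \<^bold>\<or> B))"
| Ax7: "S_axiom (B \<^bold>\<rightarrow> (A \<^bold>\<or> B))"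
| Ax8: "S_axiom ((A \<^bold>\<rightarrow> C) \<^bold>\<rightarrow> ((B \<^bold>\<rightarrow> C) \<^bold>\<rightarrow> ((A \<^bold>\<or> B) \<^bold>\<rightarrow> C)))"
| AxM1: "S_axiom ((A \<^bold>\<rightarrow> B) \<^bold>\<supset> (A \<^bold>\<supset> B))"
| AxM2: "S_axiom ((A \<^bold>\<supset> (B \<^bold>\<supset> C)) \<^bold>\<rightarrow> ((A \<^bold>\<supset> B) \<^bold>\<supset> (A \<^bold>\<supset> C)))"
| AxM3: "S_axiom ((A \<^bold>\<supset> (B \<^bold>\<rightarrow> C)) \<^bold>\<rightarrow> (B \<^bold>\<rightarrow> (A \<^bold>\<supset> C)))"
| AxM4: "S_axiom ((A \<^bold>\<rightarrow> (B \<^bold>\<supset> C)) \<^bold>\<rightarrow> (B \<^bold>\<supset> (A \<^bold>\<rightarrow> C)))"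
| AxM5: "S_axiom (((A \<^bold>\<supset> B) \<^bold>\<supset> C) \<^bold>\<rightarrow> ((A \<^bold>\<supset> C) \<^bold>\<rightarrow> C))"
| AxM6: "S_axiom ((A \<^bold>\<supset> C) \<^bold>\<rightarrow> ((B \<^bold>\<supset> C) \<^bold>\<rightarrow> ((A \<^bold>\<or> B) \<^bold>\<supset> C)))"

definition is_derivation :: "'p form set \<Rightarrow> 'p form list \<Rightarrow> bool" where
  "is_derivation \<Gamma> ds \<longleftrightarrow>
     (\<forall>i<length ds. ds ! i \<in> \<Gamma> \<or> S_axiom (ds ! i) \<or>
        (\<exists>j<i. \<exists>k<i. ds ! k = (ds ! j \<^bold>\<supset> ds ! i)))"

definition derives :: "'p form set \<Rightarrow> 'p form \<Rightarrow> bool"  (infix "\<turnstile>" 50) where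
  "\<Gamma> \<turnstile> A \<longleftrightarrow> (\<exists>ds. ds \<noteq> [] \<and> last ds = A \<and> is_derivation \<Gamma> ds)"

end

theory Submission
  imports Defs
begin

text \<open>At the base world, \<supset> is material implication, so (MP) preserves truth there; it
  remains to check that every axiom is true at the base (\<open>S_axiom_valid\<close>). That check
  rests on persistence of truth along the accessibility relation (\<open>interp_mono\<close>), and
  induction on positions in a derivation (\<open>interp_if_derivation\<close>) concludes.\<close>

lemma S_modelD:
  assumes "S_model M"
  shows S_model_base: "base M \<in> worlds M"
    and S_model_preorder: "preorder_on (worlds M) (acc M)"
    and S_model_val_mono:
      "\<lbrakk>w \<in> worlds M; x \<in> worlds M; val M w p; (w, x) \<in> acc M\<rbrakk> \<Longrightarrow> val M x p"
  using assms unfolding S_model_def by blast+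

lemma S_model_refl: "S_model M \<Longrightarrow> w \<in> worlds M \<Longrightarrow> (w, w) \<in> acc M"
  using S_model_preorder[of M] unfolding preorder_on_def refl_on_def by blast

lemma S_model_trans:
  "S_model M \<Longrightarrow> (x, y) \<in> acc M \<Longrightarrow> (y, z) \<in> acc M \<Longrightarrow> (x, z) \<in> acc M"
  using S_model_preorder[of M] unfolding preorder_on_def by (blast dest: transD)

text \<open>For \<rightarrow>, transitivity puts every successor of \<open>x\<close> among those of
  \<open>w\<close>. For \<supset>, the antecedent is always read at the base, so only the consequent
  has to persist.\<close>

lemma interp_mono:
  assumes "S_model M"
  shows "\<lbrakk>interp M w A; w \<in> worlds M; x \<in> worlds M; (w, x) \<in> acc M\<rbrakk> \<Longrightarrow> interp M x A"
proof (induction A)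
  case (Var p)
  then show ?case using S_model_val_mono[OF assms, of w x p] by simp
next
  case (IImp A B)
  have "interp M y B" if "y \<in> worlds M" "(x, y) \<in> acc M" "interp M y A" for y
    using S_model_trans[OF assms IImp.prems(4) that(2)] that IImp.prems(1) by simp
  then show ?case by simp
qed auto

text \<open>Each nested \<rightarrow> moves to a later world. Hypotheses met earlier are carried
  there by transitivity if they are themselves \<rightarrow> formulas, and by persistence in
  general.\<close>

lemma S_axiom_valid:
  assumes "S_axiom A" and M: "S_model M"
  shows "interp M (base M) A"
proof -
  note base = S_model_base[OF M] and refl = S_model_refl[OF M]
    and trans = S_model_trans[OF M] and mono = interp_mono[OF M]
  from assms(1) show ?thesis
  proof cases
    case Ax1 then show ?thesis by simp (meson mono)
  next
    case Ax2 then show ?thesis by simp (meson refl trans)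
  next
    case Ax5 then show ?thesis by simp (meson trans)
  next
    case Ax8 then show ?thesis by simp (meson trans)
  next
    \<comment> \<open>Reflexivity lets the intuitionistic implication be applied at the base
      itself.\<close>
    case AxM1 then show ?thesis by simp (meson base refl)
  next
    case AxM3 then show ?thesis by auto
  next
    \<comment> \<open>If \<open>A\<close> fails at the base, then A \<supset> B holds there
      vacuously, so \<open>C\<close> holds at the earlier world and persists; otherwise A \<supset>
      C yields \<open>C\<close> at once.\<close>
    case AxM5 then show ?thesis by simp (meson mono)
  next
    case AxM6 then show ?thesis by simp (meson mono)
  qed auto
qed

text \<open>Strong induction is needed because (MP) may cite any two earlier positions.\<close>

lemma interp_if_derivation:
  assumes "is_derivation \<Gamma> ds" and M: "S_model M"
    and \<Gamma>: "\<And>B. B \<in> \<Gamma> \<Longrightarrow> interp M (base M) B"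
  shows "i < length ds \<Longrightarrow> interp M (base M) (ds ! i)"
proof (induction i rule: less_induct)
  case (less i)
  then consider "ds ! i \<in> \<Gamma>" | "S_axiom (ds ! i)"
    | j k where "j < i" "k < i" "ds ! k = (ds ! j \<^bold>\<supset> ds ! i)"
    using assms(1) unfolding is_derivation_def by blast
  then show ?case
  proof cases
    case 1
    then show ?thesis by (rule \<Gamma>)
  next
    case 2
    then show ?thesis using M by (rule S_axiom_valid)
  next
    case 3
    then show ?thesis using less.IH[of j] less.IH[of k] less.prems by simp
  qed
qed

theorem mainTheorem1:
  fixes \<Gamma> :: "'p::countable form set" and A :: "'p form"
  assumes "\<Gamma> \<turnstile> A"
  shows "entails TYPE('w) \<Gamma> A"
proof -
  obtain ds where ds: "ds \<noteq> []" "last ds = A" "is_derivation \<Gamma> ds"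
    using assms unfolding derives_def by blast
  then have "A = ds ! (length ds - 1)" "length ds - 1 < length ds"
    by (simp_all add: last_conv_nth)
  then show ?thesis
    using interp_if_derivation[OF ds(3)] unfolding entails_def by blast
qed

end
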